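(* For all $d\in\mathbb{N}$, there exists a probability measure $\mu$ on $\mathbb{R}^{d}$ with the following property. Let $(x_{i})_{1}^{\infty}$ be an i.i.d. sample from $\mu$, and for each $n\in\mathbb{N}$ with $n\geq d+1$, let $P_{n}=\operatorname{conv}\{x_{i}\}_{1}^{n}$. Then with probability $1$, the sequence $(P_{n})_{n=d+1}^{\infty}$ is dense in $\mathcal{K}_{d}$ with respect to $d_{\mathrm{BM}}$.
   Context: $\mathcal{K}_{d}$ is the collection of all convex bodies in $\mathbb{R}^{d}$ (compact convex sets with nonempty interior). For $K,L\in\mathcal{K}_{d}$, $$d_{\mathrm{BM}}(K,L)=\inf\{\lambda\geq1:\exists x\in\mathbb{R}^{d},\ \exists T,\ K\subset TL\subset\lambda(K-x)+x\},$$ where $T$ ranges over affine transformations of $\mathbb{R}^{d}$. Two bodies are at distance $1$ when they are as close as possible, so a sequence being dense with respect to $d_{\mathrm{BM}}$ means that for every $K\in\mathcal{K}_d$ and every $\varepsilon>0$ some member $P$ of the sequence satisfies $d_{\mathrm{BM}}(P,K)<1+\varepsilon$. *)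

theory Defs
  imports "HOL-Probability.Probability"
begin

definition convex_bodies :: "'a::euclidean_space set set" where
  "convex_bodies = {K. compact K \<and> convex K \<and> interior K \<noteq> {}}"

definition affine_transformation :: "('a::euclidean_space \<Rightarrow> 'a) \<Rightarrow> bool" where
  "affine_transformation T \<longleftrightarrow> (\<exists>f b. linear f \<and> bij f \<and> T = (\<lambda>y. f y + b))"

(* Only meant for convex bodies K and L: there the set is nonempty and bounded below by 1,
   so Inf is the true infimum. For such K and L the inclusion of K in T ` L already forces T
   to be invertible, so the bijectivity required above does not change the value. *)
definition bm_dist :: "'a::euclidean_space set \<Rightarrow> 'a set \<Rightarrow> real" where
  "bm_dist K L = Inf {c. 1 \<le> c \<and>
     (\<exists>x T. affine_transformation T \<and> K \<subseteq> T ` L \<and> T ` L \<subseteq> (\<lambda>y. c *\<^sub>R (y - x) + x) ` K)}"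

definition bm_dense :: "'a::euclidean_space set set \<Rightarrow> bool" where
  "bm_dense \<P> \<longleftrightarrow> \<P> \<subseteq> convex_bodies \<and>
     (\<forall>K\<in>convex_bodies. \<forall>\<epsilon>>0. \<exists>P\<in>\<P>. bm_dist P K < 1 + \<epsilon>)"

(* The sequence x is indexed from 0, so its first n terms are x 0, ..., x (n - 1). *)
definition sample_hull :: "(nat \<Rightarrow> 'a::euclidean_space) \<Rightarrow> nat \<Rightarrow> 'a set" where
  "sample_hull x n = convex hull (x ` {..<n})"

end

theory Submission
  imports Defs
begin

text \<open>
  The measure is very heavy tailed: it lives on scales that grow, and whose probabilities decay, so
  fast that the sample repeatedly forgets its past. Its law is that of \<open>a G + U\<close>, where \<open>G\<close> is a
  geometric random index, \<open>a 0, a 1, \<dots>\<close> is a deterministic sequence of atoms, and \<open>U\<close> is independent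
  and uniform on the unit ball. The atoms come in consecutive blocks. Block \<open>k\<close> lists the dilates
  \<open>R k *\<^sub>R v\<close> of the points \<open>v\<close> of a finite list \<open>L k\<close>, where every convex body has, up to any prescribed
  error, a net among these lists that recurs for infinitely many \<open>k\<close> (lemma \<open>exists_vertex_lists\<close>).

  The blocks are chosen recursively (lemma \<open>exists_atoms\<close>). Once the atoms before the end of the
  list in block \<open>k\<close> are placed, each has positive probability, so a number \<open>N k\<close> exists for which
  \<open>N k\<close> sample points come close to all of \<open>R k *\<^sub>R v\<close> with probability at least \<open>1 - 2\<^sup>-\<^sup>k\<close>. The next
  block starts so late that \<open>N k\<close> sample points see it with probability at most \<open>2\<^sup>-\<^sup>k\<close>, and
  \<open>R (k + 1)\<close> dwarfs all earlier atoms. By the Borel-Cantelli lemma, almost surely for all large \<open>k\<close>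
  the first \<open>N k\<close> points hit every vertex of block \<open>k\<close> and nothing beyond it, while whatever else
  they hit is negligible at scale \<open>R k\<close>, as is the displacement by \<open>U\<close>.

  It remains to see that a hull of points which are close to a net of a convex body \<open>K\<close> is
  Banach-Mazur close to \<open>K\<close> (lemma \<open>bm_dist_convex_hull_le\<close>). If \<open>K\<close> contains a ball of radius \<open>r\<close>
  around the origin, an additive error \<open>\<eta>\<close> is absorbed by the dilation factor \<open>1 + \<eta> / r\<close> from
  outside, and by \<open>1 - \<eta> / r\<close> from inside.

  The displacement \<open>U\<close> makes the measure absolutely continuous. Hence almost surely none of the
  first \<open>d + 1\<close> sample points lies in the affine hull of its predecessors, and all the hulls in
  question have nonempty interior.
\<close>

section \<open>Hulls near a convex body\<close>

text \<open>
  The infimum of a linear functional over \<open>Q\<close> exceeds its minimum over \<open>C\<close> by at most \<open>\<eta>\<close> times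
  its norm, while the minimum over \<open>C\<close> is at most \<open>- r\<close> times its norm. So shrinking \<open>C\<close>
  by the factor \<open>1 - \<eta> / r\<close> raises its minimum to at least the infimum over \<open>Q\<close>, and no hyperplane separates a point of the
  shrunken \<open>C\<close> from \<open>Q\<close>.
\<close>

lemma shrink_mem_of_near:
  fixes C Q :: "'a::euclidean_space set"
  assumes C: "compact C" "cball 0 r \<subseteq> C" and Q: "closed Q" "convex Q"
    and \<eta>: "0 \<le> \<eta>" "\<eta> < r"
    and near: "\<And>y. y \<in> C \<Longrightarrow> \<exists>p\<in>Q. dist p y \<le> \<eta>"
    and y: "y \<in> C"
  shows "(1 - \<eta> / r) *\<^sub>R y \<in> Q"
proof (rule ccontr)
  assume "(1 - \<eta> / r) *\<^sub>R y \<notin> Q"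
  then obtain a b where ab: "a \<bullet> ((1 - \<eta> / r) *\<^sub>R y) < b" "\<And>p. p \<in> Q \<Longrightarrow> b < a \<bullet> p"
    using separating_hyperplane_closed_point[OF Q(2,1)] by metis
  have "continuous_on C (\<lambda>q. a \<bullet> q)" by (intro continuous_intros)
  then obtain q where q: "q \<in> C" "\<And>x. x \<in> C \<Longrightarrow> a \<bullet> q \<le> a \<bullet> x"
    using continuous_attains_inf[OF C(1)] y by blast
  have r: "0 < r" using \<eta> by linarith
  obtain p where p: "p \<in> Q" "dist p q \<le> \<eta>" using near[OF q(1)] by blast
  have "a \<bullet> (p - q) \<le> norm a * norm (p - q)" by (rule norm_cauchy_schwarz)
  also have "\<dots> \<le> norm a * \<eta>" using p(2) by (simp add: dist_norm mult_left_mono)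
  finally have pq: "a \<bullet> p \<le> a \<bullet> q + norm a * \<eta>" by (simp add: inner_diff_right)
  have low: "a \<bullet> q \<le> - (r * norm a)"
  proof (cases "a = 0")
    case False
    \<comment> \<open>The point of the ball where the functional is smallest.\<close>
    have "- (r / norm a) *\<^sub>R a \<in> cball 0 r" using r False by simp
    then have "a \<bullet> q \<le> a \<bullet> (- (r / norm a) *\<^sub>R a)" using C(2) q(2) by blast
    also have "\<dots> = - (r * norm a)" using False by (simp add: dot_square_norm power2_eq_square)
    finally show ?thesis .
  qed simp
  have "(1 - \<eta> / r) * (a \<bullet> q) \<le> (1 - \<eta> / r) * (a \<bullet> y)"
    using q(2)[OF y] r \<eta> by (intro mult_left_mono) (auto simp: field_simps)
  then have "(1 - \<eta> / r) * (a \<bullet> q) < a \<bullet> q + norm a * \<eta>"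
    using ab(1) ab(2)[OF p(1)] pq by simp
  then have "- (\<eta> / r) * (a \<bullet> q) < norm a * \<eta>" by (simp add: algebra_simps)
  moreover have "norm a * \<eta> = (\<eta> / r) * (r * norm a)" using r by simp
  moreover have "(\<eta> / r) * (r * norm a) \<le> (\<eta> / r) * (- (a \<bullet> q))"
    using low \<eta> r by (intro mult_left_mono) auto
  ultimately show False by simp
qed

text \<open>
  An error vector of length at most \<open>\<eta>\<close> is \<open>\<eta> / r\<close> times a point of \<open>C\<close>, and
  \<open>C + s *\<^sub>R C = (1 + s) *\<^sub>R C\<close> for a convex set \<open>C\<close>.
\<close>

lemma convex_hull_subset_dilate:
  fixes C X :: "'a::euclidean_space set"
  assumes C: "convex C" "cball 0 r \<subseteq> C" and \<eta>: "0 < \<eta>" and r: "0 < r"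
    and near: "\<And>x. x \<in> X \<Longrightarrow> \<exists>y\<in>C. dist x y \<le> \<eta>"
  shows "convex hull X \<subseteq> (*\<^sub>R) (1 + \<eta> / r) ` C"
proof (rule hull_minimal)
  show "convex ((*\<^sub>R) (1 + \<eta> / r) ` C)" using C(1) by (rule convex_scaling)
  show "X \<subseteq> (*\<^sub>R) (1 + \<eta> / r) ` C"
  proof
    fix x assume "x \<in> X"
    then obtain y where y: "y \<in> C" "dist x y \<le> \<eta>" using near by blast
    define w where "w = (r / \<eta>) *\<^sub>R (x - y)"
    have "norm w = (r / \<eta>) * norm (x - y)" using \<eta> r by (simp add: w_def del: scaleR_diff_right)
    also have "\<dots> \<le> (r / \<eta>) * \<eta>" using y(2) \<eta> r by (intro mult_left_mono) (auto simp: dist_norm)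
    also have "\<dots> = r" using \<eta> by simp
    finally have "norm w \<le> r" .
    then have w: "w \<in> C" using C(2) by auto
    define t where "t = 1 / (1 + \<eta> / r)"
    have pos: "0 < 1 + \<eta> / r" using \<eta> r by (simp add: add_pos_pos)
    then have t: "0 \<le> t" "(\<eta> / r) * t \<ge> 0" "(1 + \<eta> / r) * t = 1"
      using \<eta> r by (auto simp: t_def)
    from t(3) have sum: "t + (\<eta> / r) * t = 1" by (simp add: distrib_right)
    have "t *\<^sub>R y + ((\<eta> / r) * t) *\<^sub>R w \<in> C" using C(1) y(1) w t sum by (intro convexD) auto
    moreover have "x = (1 + \<eta> / r) *\<^sub>R (t *\<^sub>R y + ((\<eta> / r) * t) *\<^sub>R w)"
    proof -
      have "(1 + \<eta> / r) *\<^sub>R (t *\<^sub>R y + ((\<eta> / r) * t) *\<^sub>R w)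
          = ((1 + \<eta> / r) * t) *\<^sub>R y + (((1 + \<eta> / r) * t) * (\<eta> / r)) *\<^sub>R w"
        by (simp only: scaleR_add_right scaleR_scaleR ac_simps)
      also have "\<dots> = y + (\<eta> / r) *\<^sub>R w" by (simp only: t(3) scaleR_one mult_1)
      also have "\<dots> = x" using \<eta> r by (simp add: w_def)
      finally show ?thesis by simp
    qed
    ultimately show "x \<in> (*\<^sub>R) (1 + \<eta> / r) ` C" by blast
  qed
qed

text \<open>
  Both inclusions are applied to the copy \<open>R *\<^sub>R (K - z)\<close> of \<open>K\<close>, which contains a ball of
  radius \<open>R * r\<close> around the origin. The hypotheses say that \<open>X\<close> and this copy are within Hausdorff
  distance \<open>R * \<eta>\<close>.
\<close>

lemma bm_dist_convex_hull_le:
  fixes K X :: "'a::euclidean_space set"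
  assumes K: "compact K" "convex K" "cball z r \<subseteq> K" and X: "finite X" and R: "0 < R"
    and \<eta>: "0 < \<eta>" "\<eta> < r"
    and near_K: "\<And>x. x \<in> X \<Longrightarrow> \<exists>y\<in>K. dist x (R *\<^sub>R (y - z)) \<le> R * \<eta>"
    and near_X: "\<And>y. y \<in> K \<Longrightarrow> \<exists>x\<in>X. dist x (R *\<^sub>R (y - z)) \<le> R * \<eta>"
  shows "bm_dist (convex hull X) K \<le> (1 + \<eta> / r) / (1 - \<eta> / r)"
proof -
  define C where "C = (\<lambda>y. R *\<^sub>R (y - z)) ` K"
  define P where "P = convex hull X"
  define s where "s = \<eta> / r"
  have r: "0 < r" using \<eta> by linarith
  have s: "0 < s" "s < 1" using \<eta> r by (auto simp: s_def)
  have C_alt: "C = (*\<^sub>R) R ` ((\<lambda>y. - z + y) ` K)" by (simp add: C_def image_image)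
  have C: "compact C" "convex C"
    unfolding C_alt
    by (rule compact_scaling[OF compact_translation[OF K(1)]], rule convex_scaling[OF convex_translation[OF K(2)]])
  have ball: "cball 0 (R * r) \<subseteq> C"
  proof
    fix v :: 'a assume v: "v \<in> cball 0 (R * r)"
    then have "z + (1 / R) *\<^sub>R v \<in> cball z r" using R by (simp add: dist_norm field_simps)
    then have "R *\<^sub>R ((z + (1 / R) *\<^sub>R v) - z) \<in> C" unfolding C_def using K(3) by blast
    then show "v \<in> C" using R by simp
  qed
  have eq: "(R * \<eta>) / (R * r) = s" using R by (simp add: s_def)
  have up: "P \<subseteq> (*\<^sub>R) (1 + s) ` C"
    unfolding P_def eq[symmetric]
    by (rule convex_hull_subset_dilate) (use C ball R \<eta> r near_K in \<open>auto simp: C_def\<close>)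
  have low: "(1 - s) *\<^sub>R y \<in> P" if "y \<in> C" for y
    unfolding eq[symmetric]
  proof (rule shrink_mem_of_near[OF C(1) ball _ _ _ _ _ that])
    show "closed P" unfolding P_def by (simp add: X compact_imp_closed finite_imp_compact_convex_hull)
    show "convex P" unfolding P_def by (rule convex_convex_hull)
    fix y assume "y \<in> C"
    then obtain v where v: "v \<in> K" "y = R *\<^sub>R (v - z)" by (auto simp: C_def)
    show "\<exists>p\<in>P. dist p y \<le> R * \<eta>"
      using near_X[OF v(1)] v(2) hull_inc[of _ X convex] unfolding P_def by blast
  qed (use R \<eta> in auto)
  \<comment> \<open>The dilation is centred at the origin, which is the image of \<open>z\<close> under \<open>T\<close>.\<close>
  define c where "c = (1 + s) / (1 - s)"
  define T where "T = (\<lambda>y. ((1 + s) * R) *\<^sub>R y + (- ((1 + s) * R) *\<^sub>R z))"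
  have nz: "(1 + s) * R \<noteq> 0" using s R by auto
  have "linear (\<lambda>y::'a. ((1 + s) * R) *\<^sub>R y)" by (rule linear_scaleR)
  moreover have "bij (\<lambda>y::'a. ((1 + s) * R) *\<^sub>R y)"
    by (rule o_bij[of "\<lambda>y. (1 / ((1 + s) * R)) *\<^sub>R y"]) (use nz in \<open>auto simp: fun_eq_iff\<close>)
  ultimately have aff: "affine_transformation T"
    unfolding affine_transformation_def T_def by blast
  have TK: "T ` K = (*\<^sub>R) (1 + s) ` C"
    by (simp add: T_def C_def image_image algebra_simps)
  have "(*\<^sub>R) (1 + s) ` C \<subseteq> (\<lambda>y. c *\<^sub>R (y - 0) + 0) ` P"
  proof
    fix x assume "x \<in> (*\<^sub>R) (1 + s) ` C"
    then obtain y where y: "y \<in> C" "x = (1 + s) *\<^sub>R y" by blast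
    have "x = c *\<^sub>R ((1 - s) *\<^sub>R y - 0) + 0" using s y(2) by (simp add: c_def)
    then show "x \<in> (\<lambda>y. c *\<^sub>R (y - 0) + 0) ` P" using low[OF y(1)] by blast
  qed
  then have "\<exists>x T. affine_transformation T \<and> P \<subseteq> T ` K \<and> T ` K \<subseteq> (\<lambda>y. c *\<^sub>R (y - x) + x) ` P"
    using aff up by (intro exI[of _ 0] exI[of _ T]) (simp only: TK)
  moreover have "1 \<le> c" using s by (simp add: c_def)
  ultimately have "bm_dist P K \<le> c"
    unfolding bm_dist_def by (intro cInf_lower) (auto intro: bdd_belowI[of _ 1])
  then show ?thesis by (simp add: P_def c_def s_def)
qed

section \<open>General position of an absolutely continuous sample\<close>

lemma span_image_lessThan:
  fixes v :: "nat \<Rightarrow> 'a::real_vector"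
  shows "span (v ` {..<m}) = range (\<lambda>c. \<Sum>j<m. c j *\<^sub>R v j)"
proof
  show "span (v ` {..<m}) \<subseteq> range (\<lambda>c. \<Sum>j<m. c j *\<^sub>R v j)"
  proof (rule span_minimal)
    show "v ` {..<m} \<subseteq> range (\<lambda>c. \<Sum>j<m. c j *\<^sub>R v j)"
    proof
      fix u assume "u \<in> v ` {..<m}"
      then obtain i where i: "i < m" "u = v i" by blast
      have "(\<Sum>j<m. (if j = i then 1 else 0) *\<^sub>R v j) = (\<Sum>j<m. if j = i then v j else 0)"
        by (intro sum.cong) auto
      also have "\<dots> = u" using i by simp
      finally have eq: "(\<Sum>j<m. (if j = i then 1 else 0) *\<^sub>R v j) = u" .
      show "u \<in> range (\<lambda>c. \<Sum>j<m. c j *\<^sub>R v j)"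
        by (rule image_eqI[where x = "\<lambda>j. if j = i then 1 else 0"], rule eq[symmetric], rule UNIV_I)
    qed
    show "subspace (range (\<lambda>c. \<Sum>j<m. c j *\<^sub>R v j))"
    proof (rule subspaceI)
      show "0 \<in> range (\<lambda>c. \<Sum>j<m. c j *\<^sub>R v j)" by (rule range_eqI[of _ _ "\<lambda>_. 0"]) simp
    next
      fix x y assume "x \<in> range (\<lambda>c. \<Sum>j<m. c j *\<^sub>R v j)" "y \<in> range (\<lambda>c. \<Sum>j<m. c j *\<^sub>R v j)"
      then obtain c c' where "x = (\<Sum>j<m. c j *\<^sub>R v j)" "y = (\<Sum>j<m. c' j *\<^sub>R v j)" by blast
      then show "x + y \<in> range (\<lambda>c. \<Sum>j<m. c j *\<^sub>R v j)"
        by (intro range_eqI[of _ _ "\<lambda>j. c j + c' j"]) (simp add: scaleR_add_left sum.distrib)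
    next
      fix a x assume "x \<in> range (\<lambda>c. \<Sum>j<m. c j *\<^sub>R v j)"
      then obtain c where "x = (\<Sum>j<m. c j *\<^sub>R v j)" by blast
      then show "a *\<^sub>R x \<in> range (\<lambda>c. \<Sum>j<m. c j *\<^sub>R v j)"
        by (intro range_eqI[of _ _ "\<lambda>j. a * c j"]) (simp add: scaleR_sum_right)
    qed
  qed
  show "range (\<lambda>c. \<Sum>j<m. c j *\<^sub>R v j) \<subseteq> span (v ` {..<m})"
    by (intro image_subsetI span_sum span_scale span_base) simp
qed

text \<open>
  Membership in an affine hull is a quantification over real coefficients. The hull is closed
  and rational combinations are dense in it, so countably many conditions suffice; this is what makes
  the event that a sample point lies in the hull of earlier ones measurable.
\<close>

lemma mem_affine_hull_iff_rational_approx: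
  fixes x :: "nat \<Rightarrow> 'a::euclidean_space"
  shows "y \<in> affine hull (x ` {..<Suc m}) \<longleftrightarrow>
    (\<forall>n. \<exists>l::rat list.
      dist (x 0 + (\<Sum>j<m. of_rat (l ! j) *\<^sub>R (x (Suc j) - x 0))) y < 1 / real (Suc n))"
    (is "?L \<longleftrightarrow> ?R")
proof -
  define v where "v = (\<lambda>j. x (Suc j) - x 0)"
  define A where "A = affine hull (x ` {..<Suc m})"
  have x0: "x 0 \<in> A" and xj: "\<And>j. j < m \<Longrightarrow> x (Suc j) \<in> A"
    unfolding A_def by (auto intro!: hull_inc)
  have img: "x ` {..<Suc m} = insert (x 0) ((\<lambda>j. x (Suc j)) ` {..<m})"
    by (auto simp: lessThan_Suc_eq_insert_0 image_image)
  have rep: "y \<in> A \<longleftrightarrow> (\<exists>c. y = x 0 + (\<Sum>j<m. c j *\<^sub>R v j))" for y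
  proof -
    have "A = (+) (x 0) ` span ((\<lambda>t. - x 0 + t) ` (\<lambda>j. x (Suc j)) ` {..<m})"
      unfolding A_def img by (rule affine_hull_insert_span_gen)
    also have "(\<lambda>t. - x 0 + t) ` (\<lambda>j. x (Suc j)) ` {..<m} = v ` {..<m}"
      by (simp add: v_def image_image)
    finally show ?thesis unfolding span_image_lessThan by blast
  qed
  show ?thesis
  proof
    assume ?L
    then obtain c where c: "y = x 0 + (\<Sum>j<m. c j *\<^sub>R v j)" using rep A_def by blast
    show ?R
    proof
      fix n
      \<comment> \<open>The summand 1 keeps \<open>D\<close> positive when all \<open>v j\<close> vanish.\<close>
      define D where "D = (\<Sum>j<m. norm (v j)) + 1"
      have D: "D > 0" unfolding D_def by (intro add_nonneg_pos sum_nonneg) auto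
      have "\<forall>j. \<exists>q::rat. \<bar>of_rat q - c j\<bar> < 1 / (real (Suc n) * D)"
      proof
        fix j
        have "c j < c j + 1 / (real (Suc n) * D)" using D by simp
        from of_rat_dense[OF this] obtain q where "c j < of_rat q" "of_rat q < c j + 1 / (real (Suc n) * D)" by blast
        then show "\<exists>q::rat. \<bar>of_rat q - c j\<bar> < 1 / (real (Suc n) * D)" by (intro exI[of _ q]) auto
      qed
      then obtain q :: "nat \<Rightarrow> rat" where q: "\<And>j. \<bar>of_rat (q j) - c j\<bar> < 1 / (real (Suc n) * D)" by metis
      define l where "l = map q [0..<m]"
      have "dist (x 0 + (\<Sum>j<m. of_rat (l ! j) *\<^sub>R v j)) y = norm (\<Sum>j<m. (of_rat (q j) - c j) *\<^sub>R v j)"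
        by (simp add: c dist_norm l_def scaleR_diff_left sum_subtractf)
      also have "\<dots> \<le> (\<Sum>j<m. (1 / (real (Suc n) * D)) * norm (v j))"
        by (intro sum_norm_le)
             (simp only: norm_scaleR mult_right_mono[OF less_imp_le[OF q] norm_ge_zero])
      also have "\<dots> = (1 / (real (Suc n) * D)) * (D - 1)" by (simp add: D_def sum_distrib_left)
      also have "\<dots> < (1 / (real (Suc n) * D)) * D" using D by (intro mult_strict_left_mono) auto
      also have "\<dots> = 1 / real (Suc n)" using D by simp
      finally show "\<exists>l::rat list.
          dist (x 0 + (\<Sum>j<m. of_rat (l ! j) *\<^sub>R (x (Suc j) - x 0))) y < 1 / real (Suc n)"
        unfolding v_def by (rule exI)
    qed
  next
    assume R: ?R
    have "y \<in> closure A"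
      unfolding closure_approachable
    proof (intro allI impI)
      fix e :: real assume "e > 0"
      then obtain n where n: "1 / real (Suc n) < e" using nat_approx_posE by metis
      from R obtain l :: "rat list" where l: "dist (x 0 + (\<Sum>j<m. of_rat (l ! j) *\<^sub>R v j)) y < 1 / real (Suc n)"
        unfolding v_def by blast
      moreover have "x 0 + (\<Sum>j<m. of_rat (l ! j) *\<^sub>R v j) \<in> A" by (subst rep) (rule exI, rule refl)
      ultimately show "\<exists>p\<in>A. dist p y < e" using n by (intro bexI) (rule less_trans)
    qed
    then show ?L unfolding A_def by (simp add: closure_closed[OF closed_affine_hull])
  qed
qed

lemma negligible_affine_hull_few:
  fixes S :: "'a::euclidean_space set"
  assumes "finite S" "card S \<le> DIM('a)"
  shows "negligible (affine hull S)"
  using empty_interior_affine_hull[OF assms] negligible_convex_interior[of "affine hull S"]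
    affine_imp_convex[OF affine_affine_hull] by blast

text \<open>
  The sequence is split at \<open>i\<close> into two independent halves. For a fixed first half, the affine hull of
  \<open>i\<close> points is a null set, and Fubini's theorem does the rest.
\<close>

lemma AE_not_in_affine_hull_of_earlier:
  fixes \<mu> :: "'a::euclidean_space measure"
  assumes "prob_space \<mu>" and [measurable_cong]: "sets \<mu> = sets borel"
    and ac: "absolutely_continuous lborel \<mu>" and i: "i \<le> DIM('a)"
  shows "AE x in (\<Pi>\<^sub>M i\<in>(UNIV::nat set). \<mu>). x i \<notin> affine hull (x ` {..<i})"
proof (cases i)
  case (Suc m)
  interpret \<mu>: prob_space \<mu> by fact
  interpret sequence_space \<mu> ..
  interpret SS: pair_prob_space S S ..
  let ?P = "\<lambda>x. x i \<in> affine hull (x ` {..<i})"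
  have [measurable]: "Measurable.pred S ?P"
    unfolding Suc mem_affine_hull_iff_rational_approx by measurable
  have eq: "?P (comb_seq i \<omega> \<omega>') \<longleftrightarrow> \<omega>' 0 \<in> affine hull (\<omega> ` {..<i})" for \<omega> \<omega>' :: "nat \<Rightarrow> 'a"
  proof -
    have "comb_seq i \<omega> \<omega>' ` {..<i} = \<omega> ` {..<i}" by (intro image_cong) (auto simp: comb_seq_less)
    then show ?thesis using comb_seq_add[of i \<omega> \<omega>' 0] by simp
  qed
  have meas: "Measurable.pred (S \<Otimes>\<^sub>M S) (\<lambda>p. \<not> ?P (comb_seq i (fst p) (snd p)))"
    by measurable
  have "AE p in S \<Otimes>\<^sub>M S. \<not> ?P (comb_seq i (fst p) (snd p))"
  proof (rule SS.AE_pair_measure)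
    show "{p \<in> space (S \<Otimes>\<^sub>M S). \<not> ?P (comb_seq i (fst p) (snd p))} \<in> sets (S \<Otimes>\<^sub>M S)"
      using meas by (simp add: pred_def)
    show "AE \<omega> in S. AE \<omega>' in S. \<not> ?P (comb_seq i (fst (\<omega>, \<omega>')) (snd (\<omega>, \<omega>')))"
    proof (rule AE_I2)
      fix \<omega> :: "nat \<Rightarrow> 'a"
      let ?A = "affine hull (\<omega> ` {..<i})"
      have "card (\<omega> ` {..<i}) \<le> DIM('a)" using card_image_le[of "{..<i}" \<omega>] i by simp
      then have "negligible ?A" by (intro negligible_affine_hull_few) auto
      then have "?A \<in> null_sets lborel"
        by (simp add: negligible_iff_null_sets null_sets_completion_iff closed_affine_hull)
      then have "AE y in \<mu>. y \<notin> ?A" using ac by (auto simp: absolutely_continuous_def intro: AE_not_in)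
      then have "AE \<omega>' in S. \<omega>' 0 \<notin> ?A" by (rule AE_component[rotated]) simp
      then show "AE \<omega>' in S. \<not> ?P (comb_seq i (fst (\<omega>, \<omega>')) (snd (\<omega>, \<omega>')))"
        unfolding fst_conv snd_conv eq .
    qed
  qed
  then have "AE p in S \<Otimes>\<^sub>M S. \<not> ?P ((\<lambda>(\<omega>, \<omega>'). comb_seq i \<omega> \<omega>') p)" by (simp add: case_prod_beta)
  then have "AE x in distr (S \<Otimes>\<^sub>M S) S (\<lambda>(\<omega>, \<omega>'). comb_seq i \<omega> \<omega>'). \<not> ?P x"
    by (rule AE_distr_iff[OF measurable_comb_seq, THEN iffD2, rotated]) measurable
  then show ?thesis unfolding PiM_comb_seq .
qed simp

lemma sample_hull_convex_body:
  fixes x :: "nat \<Rightarrow> 'a::euclidean_space"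
  assumes gen: "\<And>i. i \<le> DIM('a) \<Longrightarrow> x i \<notin> affine hull (x ` {..<i})" and n: "n \<ge> DIM('a) + 1"
  shows "sample_hull x n \<in> convex_bodies"
proof -
  let ?d = "DIM('a)"
  have ind: "i \<le> Suc ?d \<Longrightarrow> \<not> affine_dependent (x ` {..<i}) \<and> card (x ` {..<i}) = i" for i
  proof (induction i)
    case (Suc i)
    then have "x i \<notin> affine hull (x ` {..<i})" using gen by simp
    moreover from this have "x i \<notin> x ` {..<i}" using hull_inc by metis
    ultimately show ?case
      using Suc by (simp add: lessThan_Suc affine_independent_insert)
  qed simp
  have "interior (convex hull (x ` {..<Suc ?d})) \<noteq> {}"
    using ind[of "Suc ?d"] interior_convex_hull_eq_empty[of "x ` {..<Suc ?d}"] by simp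
  moreover have "convex hull (x ` {..<Suc ?d}) \<subseteq> sample_hull x n"
    unfolding sample_hull_def using n by (intro hull_mono image_mono) auto
  ultimately have "interior (sample_hull x n) \<noteq> {}" using interior_mono by blast
  then show ?thesis
    by (simp add: convex_bodies_def sample_hull_def finite_imp_compact_convex_hull)
qed

section \<open>Randomly displaced atoms\<close>

definition jittered :: "nat pmf \<Rightarrow> (nat \<Rightarrow> 'a::euclidean_space) \<Rightarrow> 'a measure" where
  "jittered p a = distr (measure_pmf p \<Otimes>\<^sub>M uniform_measure lborel (ball 0 1)) borel (\<lambda>(g, u). a g + u)"

lemma sets_jittered [simp, measurable_cong]: "sets (jittered p a) = sets borel"
  by (simp add: jittered_def)

lemma emeasure_unit_ball:
  "emeasure lborel (ball (0::'a::euclidean_space) 1) \<noteq> 0" "emeasure lborel (ball (0::'a) 1) \<noteq> \<infinity>"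
proof -
  have "\<not> negligible (ball (0::'a) 1)" by (intro open_not_negligible) auto
  then show "emeasure lborel (ball (0::'a) 1) \<noteq> 0"
    by (auto simp: negligible_iff_null_sets null_sets_completion_iff null_sets_def)
  show "emeasure lborel (ball (0::'a) 1) \<noteq> \<infinity>"
    using emeasure_lborel_ball_finite[of "0::'a" 1] by (simp add: less_top)
qed

lemma prob_space_uniform_unit_ball: "prob_space (uniform_measure lborel (ball (0::'a::euclidean_space) 1))"
  by (intro prob_space_uniform_measure emeasure_unit_ball)

lemma measurable_jitter:
  "(\<lambda>(g, u). a g + u) \<in> measure_pmf p \<Otimes>\<^sub>M uniform_measure lborel (ball (0::'a::euclidean_space) 1) \<rightarrow>\<^sub>M borel"
proof -
  have [measurable_cong]: "sets (uniform_measure lborel (ball (0::'a) 1)) = sets borel" by simp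
  have [measurable]: "a \<in> measure_pmf p \<rightarrow>\<^sub>M borel" by simp
  show ?thesis by measurable
qed

lemma prob_space_jittered: "prob_space (jittered p a)"
  unfolding jittered_def
  by (intro prob_space.prob_space_distr prob_space_pair prob_space_measure_pmf
      prob_space_uniform_unit_ball measurable_jitter)

lemma absolutely_continuous_jittered:
  fixes a :: "nat \<Rightarrow> 'a::euclidean_space"
  shows "absolutely_continuous lborel (jittered p a)"
  unfolding absolutely_continuous_def
proof
  fix N :: "'a set" assume N: "N \<in> null_sets lborel"
  let ?U = "uniform_measure lborel (ball (0::'a) 1)"
  interpret U: prob_space ?U by (rule prob_space_uniform_unit_ball)
  interpret pair_prob_space "measure_pmf p" ?U ..
  have [measurable]: "N \<in> sets borel" using N by auto
  have "AE u in ?U. a g + u \<notin> N" for g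
  proof (rule AE_uniform_measureI)
    have "AE y in lborel. y \<notin> N" using N by (rule AE_not_in)
    then have "AE y in distr lborel borel ((+) (a g)). y \<notin> N"
      unfolding lborel_distr_plus .
    then have "AE u in lborel. a g + u \<notin> N" by (subst (asm) AE_distr_iff) auto
    then show "AE u in lborel. u \<in> ball 0 1 \<longrightarrow> a g + u \<notin> N" by auto
  qed simp
  moreover have "{q \<in> space (measure_pmf p \<Otimes>\<^sub>M ?U). a (fst q) + snd q \<notin> N} \<in> sets (measure_pmf p \<Otimes>\<^sub>M ?U)"
    using measurable_sets[OF measurable_jitter, of "- N" a p]
    by (simp add: vimage_def case_prod_beta Int_def conj_commute)
  ultimately have "AE q in measure_pmf p \<Otimes>\<^sub>M ?U. a (fst q) + snd q \<notin> N"
    by (intro AE_pair_measure) auto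
  then have "AE y in jittered p a. y \<notin> N"
    unfolding jittered_def by (subst AE_distr_iff[OF measurable_jitter]) (auto simp: case_prod_beta)
  then show "N \<in> null_sets (jittered p a)"
    by (subst (asm) AE_iff_null_sets[symmetric]) auto
qed

text \<open>
  The displacement almost surely stays in the unit ball, so an index in \<open>G\<close> produces a point of
  the union.
\<close>

lemma measure_jittered_balls_ge:
  fixes a :: "nat \<Rightarrow> 'a::euclidean_space"
  shows "measure_pmf.prob p G \<le> measure (jittered p a) (\<Union>g\<in>G. ball (a g) 1)"
proof -
  let ?U = "uniform_measure lborel (ball (0::'a) 1)"
  interpret U: prob_space ?U by (rule prob_space_uniform_unit_ball)
  interpret pair_prob_space "measure_pmf p" ?U ..
  have "emeasure ?U (ball 0 1) = 1"
    by (intro emeasure_uniform_measure_1 emeasure_unit_ball)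
  then have "measure_pmf.prob p G = measure (measure_pmf p \<Otimes>\<^sub>M ?U) (G \<times> ball 0 1)"
    by (simp add: measure_def U.emeasure_pair_measure_Times)
  also have "\<dots> \<le> measure (measure_pmf p \<Otimes>\<^sub>M ?U)
      ((\<lambda>(g, u). a g + u) -` (\<Union>g\<in>G. ball (a g) 1) \<inter> space (measure_pmf p \<Otimes>\<^sub>M ?U))"
  proof (rule finite_measure_mono)
    show "(\<lambda>(g, u). a g + u) -` (\<Union>g\<in>G. ball (a g) 1) \<inter> space (measure_pmf p \<Otimes>\<^sub>M ?U) \<in> sets (measure_pmf p \<Otimes>\<^sub>M ?U)"
      by (rule measurable_sets[OF measurable_jitter]) auto
    have "a g + u \<in> ball (a g) 1" if "u \<in> ball 0 1" for g u
      using that by (simp add: dist_norm algebra_simps)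
    then show "G \<times> ball 0 1 \<subseteq> (\<lambda>(g, u). a g + u) -` (\<Union>g\<in>G. ball (a g) 1) \<inter> space (measure_pmf p \<Otimes>\<^sub>M ?U)"
      by (fastforce simp: space_pair_measure simp del: mem_ball)
  qed
  also have "\<dots> = measure (jittered p a) (\<Union>g\<in>G. ball (a g) 1)"
    unfolding jittered_def by (rule measure_distr[OF measurable_jitter, symmetric]) auto
  finally show ?thesis .
qed

text \<open>
  A union bound: the sample escapes from \<open>W\<close> at one of \<open>N\<close> times, or all of \<open>N\<close> independent
  points miss the same target \<open>T i\<close>.
\<close>

lemma (in sequence_space) prob_miss_or_escape_le:
  assumes W [measurable]: "W \<in> sets M" and I: "finite I"
    and T [measurable]: "\<And>i. i \<in> I \<Longrightarrow> T i \<in> sets M" and q: "\<And>i. i \<in> I \<Longrightarrow> q \<le> measure M (T i)"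
  shows "{x \<in> space S. (\<exists>n<N. x n \<notin> W) \<or> (\<exists>i\<in>I. \<forall>n<N. x n \<notin> T i)} \<in> P.events" (is "?Bad \<in> _")
    and "P.prob {x \<in> space S. (\<exists>n<N. x n \<notin> W) \<or> (\<exists>i\<in>I. \<forall>n<N. x n \<notin> T i)}
      \<le> real N * (1 - measure M W) + real (card I) * (1 - q) ^ N"
proof -
  let ?E = "\<lambda>n. {x \<in> space S. x n \<in> space M - W}"
  let ?F = "\<lambda>i. {x \<in> space S. \<forall>n\<in>{..<N}. x n \<in> space M - T i}"
  have comp: "x n \<in> space M" if "x \<in> space S" for x n using that by (auto simp: space_PiM)
  have E [measurable]: "?E n \<in> P.events" for n by measurable
  have F [measurable]: "?F i \<in> P.events" if "i \<in> I" for i using T[OF that] by measurable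
  have pE: "P.prob (?E n) = 1 - measure M W" for n
  proof -
    have "measure M (space M - W) = measure (distr S M (\<lambda>x. x n)) (space M - W)"
      by (simp add: PiM_component)
    also have "\<dots> = P.prob ((\<lambda>x. x n) -` (space M - W) \<inter> space S)"
      by (rule measure_distr) auto
    also have "(\<lambda>x. x n) -` (space M - W) \<inter> space S = ?E n" by auto
    finally show ?thesis by (simp add: M.prob_compl)
  qed
  have pF: "P.prob (?F i) \<le> (1 - q) ^ N" if i: "i \<in> I" for i
  proof -
    have "?F i = emb UNIV {..<N} (Pi\<^sub>E {..<N} (\<lambda>_. space M - T i))"
      by (auto simp: prod_emb_def space_PiM)
    then have "P.prob (?F i) = (\<Prod>n<N. measure M (space M - T i))"
      using T[OF i] by (simp only:) (rule measure_PiM_emb, auto)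
    also have "\<dots> = (1 - measure M (T i)) ^ N" using T[OF i] by (simp add: M.prob_compl)
    also have "\<dots> \<le> (1 - q) ^ N" using q[OF i] by (intro power_mono) auto
    finally show ?thesis .
  qed
  have Bad: "?Bad = (\<Union>n<N. ?E n) \<union> (\<Union>i\<in>I. ?F i)"
    using comp by auto
  show "?Bad \<in> P.events" unfolding Bad using I F by (intro sets.Un sets.finite_UN) auto
  have "P.prob ?Bad \<le> P.prob (\<Union>n<N. ?E n) + P.prob (\<Union>i\<in>I. ?F i)"
    unfolding Bad using I F by (intro measure_Un_le sets.finite_UN) auto
  also have "\<dots> \<le> (\<Sum>n<N. P.prob (?E n)) + (\<Sum>i\<in>I. P.prob (?F i))"
    using I F by (intro add_mono measure_UNION_le) auto
  also have "\<dots> \<le> real N * (1 - measure M W) + real (card I) * (1 - q) ^ N"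
    by (intro add_mono sum_bounded_above pF) (simp_all only: pE sum_constant card_lessThan order_refl)
  finally show "P.prob ?Bad \<le> real N * (1 - measure M W) + real (card I) * (1 - q) ^ N" .
qed

lemma prob_geometric_half_lessThan: "measure_pmf.prob (geometric_pmf (1/2)) {..<j} = 1 - (1/2) ^ j"
proof -
  have "measure_pmf.prob (geometric_pmf (1/2)) {..<j} = (\<Sum>i<j. (1/2) ^ i * (1/2))"
    by (subst measure_measure_pmf_finite) auto
  also have "\<dots> = 1 - (1/2) ^ j" by (induction j) auto
  finally show ?thesis .
qed

section \<open>Recurring nets and the choice of atoms\<close>

text \<open>
  Lists over a countable dense set are countable, and pairing each with a counter that is then
  ignored makes every one of them recur infinitely often. Taking the vertices inside \<open>K\<close> rather than
  around it loses nothing, because the interior of a convex body is dense in it.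
\<close>

lemma exists_vertex_lists:
  obtains L :: "nat \<Rightarrow> 'a::euclidean_space list"
  where "\<And>K \<eta>. K \<in> convex_bodies \<Longrightarrow> 0 < \<eta> \<Longrightarrow>
    \<exists>F. set F \<subseteq> K \<and> (\<forall>y\<in>K. \<exists>v\<in>set F. dist v y < \<eta>) \<and> infinite {k. L k = F}"
proof -
  obtain D :: "'a set" where D: "countable D" "\<And>X. open X \<Longrightarrow> X \<noteq> {} \<Longrightarrow> \<exists>d\<in>D. d \<in> X"
    by (rule countable_dense_setE) blast
  have "D \<noteq> {}" using D(2)[of UNIV] by auto
  then have range: "range (from_nat_into D) = D" using D(1) by (rule range_from_nat_into)
  define L where "L = (\<lambda>k. map (from_nat_into D) (from_nat (fst (prod_decode k))))"
  have "\<exists>F. set F \<subseteq> K \<and> (\<forall>y\<in>K. \<exists>v\<in>set F. dist v y < \<eta>) \<and> infinite {k. L k = F}"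
    if K: "K \<in> convex_bodies" and \<eta>: "0 < \<eta>" for K \<eta>
  proof -
    have "K \<subseteq> (\<Union>v\<in>D \<inter> interior K. ball v \<eta>)"
    proof
      fix y assume "y \<in> K"
      then have "y \<in> closure (interior K)"
        using K convex_closure_interior[of K] closure_subset by (auto simp: convex_bodies_def)
      then obtain u where "u \<in> interior K" "dist u y < \<eta>"
        using \<eta> by (auto simp: closure_approachable)
      then have "interior K \<inter> ball y \<eta> \<noteq> {}" by (auto simp: dist_commute)
      then obtain v where "v \<in> D" "v \<in> interior K \<inter> ball y \<eta>"
        using D(2)[of "interior K \<inter> ball y \<eta>"] by blast
      then show "y \<in> (\<Union>v\<in>D \<inter> interior K. ball v \<eta>)" by (auto simp: dist_commute)
    qed
    moreover have "compact K" using K by (simp add: convex_bodies_def)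
    ultimately obtain V where V: "V \<subseteq> D \<inter> interior K" "finite V" "K \<subseteq> (\<Union>v\<in>V. ball v \<eta>)"
      by (elim compactE_image[where C = "D \<inter> interior K" and f = "\<lambda>v. ball v \<eta>"]) auto
    obtain vs where vs: "set vs = V" using finite_list[OF V(2)] by blast
    have "\<forall>v\<in>set vs. \<exists>i. from_nat_into D i = v" using V(1) vs range by (metis Int_iff in_mono rangeE)
    then obtain h where h: "\<And>v. v \<in> set vs \<Longrightarrow> from_nat_into D (h v) = v" by metis
    have "L (prod_encode (to_nat (map h vs), n)) = vs" for n
      using h by (simp add: L_def map_idI)
    then have "range (\<lambda>n. prod_encode (to_nat (map h vs), n)) \<subseteq> {k. L k = vs}" by blast
    moreover have "infinite (range (\<lambda>n. prod_encode (to_nat (map h vs), n)))"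
      by (rule range_inj_infinite) (auto simp: inj_def)
    ultimately have "infinite {k. L k = vs}" using infinite_super by blast
    moreover have "set vs \<subseteq> K" using V(1) vs interior_subset by blast
    moreover have "\<forall>y\<in>K. \<exists>v\<in>set vs. dist v y < \<eta>" using V(3) vs by (auto simp: subset_eq)
    ultimately show ?thesis by blast
  qed
  then show ?thesis using that by blast
qed

text \<open>
  For a geometric random index with parameter 1/2, every index below \<open>j + m\<close> has probability at least
  \<open>(1/2) ^ (j + m)\<close>, so the first bound controls the chance that \<open>N\<close> draws miss one of \<open>m\<close> such
  indices. The second one controls the chance that they reach an index \<open>j'\<close> or beyond.
\<close>

lemma exists_sample_size_and_rare_index:
  fixes m j k d :: nat
  shows "\<exists>j' N. d \<le> N \<and> j + m \<le> j' \<and> j < j' \<and>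
    real m * (1 - (1/2) ^ (j + m)) ^ N \<le> (1/2) ^ k \<and> real N * (1/2) ^ j' \<le> (1/2) ^ k"
proof -
  have "(\<lambda>N. real m * (1 - (1/2) ^ (j + m)) ^ N) \<longlonglongrightarrow> real m * 0"
    by (intro tendsto_mult tendsto_const LIMSEQ_power_zero) (auto simp: power_le_one)
  then have "\<forall>\<^sub>F N in sequentially. real m * (1 - (1/2) ^ (j + m)) ^ N < (1/2) ^ k"
    by (rule order_tendstoD) simp
  then have "\<forall>\<^sub>F N in sequentially. real m * (1 - (1/2) ^ (j + m)) ^ N < (1/2) ^ k \<and> d \<le> N"
    using eventually_ge_at_top by (rule eventually_conj)
  then obtain N where N: "real m * (1 - (1/2) ^ (j + m)) ^ N < (1/2) ^ k" "d \<le> N"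
    using eventually_happens' sequentially_bot by blast
  have "(\<lambda>i. real N * (1/2) ^ i) \<longlonglongrightarrow> real N * 0"
    by (intro tendsto_mult tendsto_const LIMSEQ_power_zero) auto
  then have "\<forall>\<^sub>F i in sequentially. real N * (1/2) ^ i < (1/2) ^ k"
    by (rule order_tendstoD) simp
  then have "\<forall>\<^sub>F i in sequentially. real N * (1/2) ^ i < (1/2) ^ k \<and> j + m + 1 \<le> i"
    using eventually_ge_at_top by (rule eventually_conj)
  then obtain j' where "real N * (1/2) ^ j' < (1/2) ^ k" "j + m + 1 \<le> j'"
    using eventually_happens' sequentially_bot by blast
  with N show ?thesis by (intro exI[of _ j'] exI[of _ N]) auto
qed

text \<open>
  Block \<open>k\<close> consists of the indices from \<open>J k\<close> to \<open>J (Suc k) - 1\<close>. It begins with the dilated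
  vertices and is padded with zeros, which delay the next block. The fourth conclusion makes the unit
  displacement small relative to \<open>R k\<close>; the last one says that at scale \<open>R k\<close> everything up to
  the end of block \<open>k\<close> other than its vertices is close to the origin, where the \<open>+ 1\<close> leaves room for
  that displacement.
\<close>

lemma exists_atoms:
  fixes L :: "nat \<Rightarrow> 'a::euclidean_space list" and d :: nat
  obtains J N :: "nat \<Rightarrow> nat" and R :: "nat \<Rightarrow> real" and a :: "nat \<Rightarrow> 'a"
  where "\<And>k. d \<le> N k"
    and "\<And>k. real (length (L k)) * (1 - (1/2) ^ (J k + length (L k))) ^ N k \<le> (1/2) ^ k"
    and "\<And>k. real (N k) * (1/2) ^ J (Suc k) \<le> (1/2) ^ k"
    and "\<And>k. real (Suc k) \<le> R k"
    and "\<And>k v. v \<in> set (L k) \<Longrightarrow> \<exists>g<J k + length (L k). a g = R k *\<^sub>R v"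
    and "\<And>k g. g < J (Suc k) \<Longrightarrow> (\<exists>v\<in>set (L k). a g = R k *\<^sub>R v) \<or> norm (a g) + 1 \<le> R k / real (Suc k)"
proof -
  obtain nxt num :: "nat \<Rightarrow> nat \<Rightarrow> nat" where nxt:
    "\<And>k j. d \<le> num k j \<and> j + length (L k) \<le> nxt k j \<and> j < nxt k j \<and>
      real (length (L k)) * (1 - (1/2) ^ (j + length (L k))) ^ num k j \<le> (1/2) ^ k \<and>
      real (num k j) * (1/2) ^ nxt k j \<le> (1/2) ^ k"
  proof -
    have "\<forall>k j. \<exists>j' N. d \<le> N \<and> j + length (L k) \<le> j' \<and> j < j' \<and>
      real (length (L k)) * (1 - (1/2) ^ (j + length (L k))) ^ N \<le> (1/2) ^ k \<and>
      real N * (1/2) ^ j' \<le> (1/2) ^ k"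
      using exists_sample_size_and_rare_index by blast
    then show ?thesis using that by metis
  qed
  define J where "J = rec_nat 0 nxt"
  define N where "N k = num k (J k)" for k
  define C where "C k = (\<Sum>v\<in>set (L k). norm v)" for k
  define R :: "nat \<Rightarrow> real" where "R = rec_nat 1 (\<lambda>k R. real (Suc (Suc k)) * (R * (C k + 1) + 1))"
  have J0: "J 0 = 0" and JS: "J (Suc k) = nxt k (J k)" for k by (simp_all add: J_def)
  have R0: "R 0 = 1" and RS: "R (Suc k) = real (Suc (Suc k)) * (R k * (C k + 1) + 1)" for k
    by (simp_all add: R_def)
  have J_step: "J k + length (L k) \<le> J (Suc k)" "J k < J (Suc k)" for k
    unfolding JS using nxt by blast+
  then have "strict_mono J" by (simp add: strict_mono_Suc_iff)
  then have mono: "\<And>k l. k \<le> l \<Longrightarrow> J k \<le> J l" by (simp add: strict_mono_less_eq)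
  have C: "0 \<le> C k" "v \<in> set (L k) \<Longrightarrow> norm v \<le> C k" for k v
    unfolding C_def by (auto intro: sum_nonneg member_le_sum)
  have R: "real (Suc k) \<le> R k" for k
  proof (induction k)
    case (Suc k)
    then have "1 \<le> R k * (C k + 1) + 1" using C(1)[of k] by simp
    then have "real (Suc (Suc k)) * 1 \<le> R (Suc k)" unfolding RS by (intro mult_left_mono) auto
    then show ?case by simp
  qed (simp add: R0)
  \<comment> \<open>The block that contains the index \<open>g\<close>.\<close>
  define blk where "blk g = (LEAST k. g < J (Suc k))" for g
  define a where "a g = (if g - J (blk g) < length (L (blk g))
      then R (blk g) *\<^sub>R (L (blk g) ! (g - J (blk g))) else 0)" for g
  have blk: "blk g = k" if "J k \<le> g" "g < J (Suc k)" for g k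
    unfolding blk_def
  proof (rule Least_equality)
    fix l assume l: "g < J (Suc l)"
    show "k \<le> l"
    proof (rule ccontr)
      assume "\<not> k \<le> l"
      then have "J (Suc l) \<le> J k" by (intro mono) simp
      then show False using l that by simp
    qed
  qed (rule that(2))
  have in_blk: "(\<exists>v\<in>set (L k). a g = R k *\<^sub>R v) \<or> a g = 0" if "J k \<le> g" "g < J (Suc k)" for g k
    unfolding a_def blk[OF that] by auto
  have small: "g < J k \<Longrightarrow> norm (a g) + 1 \<le> R k / real (Suc k)" for g k
  proof (induction k)
    case (Suc k)
    have Rk: "0 < R k" using R[of k] by simp
    have quot: "R (Suc k) / real (Suc (Suc k)) = R k * (C k + 1) + 1" unfolding RS by simp
    show ?case
    proof (cases "g < J k")
      case True
      have "R k / real (Suc k) \<le> R k" using Rk by (simp add: field_simps)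
      also have "\<dots> \<le> R k * (C k + 1) + 1" using Rk C(1)[of k] by (simp add: algebra_simps)
      finally show ?thesis using Suc.IH[OF True] unfolding quot by simp
    next
      case False
      then have "norm (a g) \<le> R k * C k"
        using in_blk[of k g] Suc.prems C Rk by (auto intro: mult_left_mono)
      then show ?thesis using Rk unfolding quot by (simp add: algebra_simps)
    qed
  qed (simp add: J0)
  show ?thesis
  proof (rule that)
    show "d \<le> N k" "real (length (L k)) * (1 - (1/2) ^ (J k + length (L k))) ^ N k \<le> (1/2) ^ k"
      "real (N k) * (1/2) ^ J (Suc k) \<le> (1/2) ^ k" for k
      unfolding N_def JS using nxt by blast+
    show "real (Suc k) \<le> R k" for k by (rule R)
    show "\<exists>g<J k + length (L k). a g = R k *\<^sub>R v" if v: "v \<in> set (L k)" for k v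
    proof -
      obtain i where i: "i < length (L k)" "L k ! i = v" using v unfolding in_set_conv_nth by blast
      then have "blk (J k + i) = k" using J_step(1)[of k] by (intro blk) auto
      then have "a (J k + i) = R k *\<^sub>R v" using i by (simp add: a_def)
      then show ?thesis using i(1) by (intro exI[of _ "J k + i"]) simp
    qed
    show "(\<exists>v\<in>set (L k). a g = R k *\<^sub>R v) \<or> norm (a g) + 1 \<le> R k / real (Suc k)" if "g < J (Suc k)" for k g
    proof (cases "g < J k")
      case False
      moreover have "1 \<le> R k / real (Suc k)" using R[of k] by (simp add: field_simps)
      ultimately show ?thesis using in_blk[of k g] that by auto
    qed (use small in blast)
  qed
qed


section \<open>Almost sure density\<close>

text \<open>
  Half of the allowed error \<open>R * \<eta>\<close> is spent on the net \<open>F\<close> of \<open>K - z\<close> and half on the unit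
  displacement of the sample points. Points near small atoms are harmless since they are close to
  the origin, which corresponds to \<open>z \<in> K\<close>.
\<close>

lemma bm_dist_sample_hull_le:
  fixes K :: "'a::euclidean_space set"
  assumes K: "compact K" "convex K" "cball z r \<subseteq> K" and \<eta>: "0 < \<eta>" "\<eta> < r"
    and R: "0 < R" "2 \<le> R * \<eta>"
    and F: "(\<lambda>v. z + v) ` F \<subseteq> K" "\<And>y. y \<in> K \<Longrightarrow> \<exists>v\<in>F. dist v (y - z) < \<eta> / 2"
    and atoms: "\<And>g. g \<in> G \<Longrightarrow> (\<exists>v\<in>F. a g = R *\<^sub>R v) \<or> norm (a g) + 1 \<le> R * \<eta>"
    and stay: "\<And>n. n < N \<Longrightarrow> x n \<in> (\<Union>g\<in>G. ball (a g) 1)"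
    and hit: "\<And>v. v \<in> F \<Longrightarrow> \<exists>n<N. x n \<in> ball (R *\<^sub>R v) 1"
  shows "bm_dist (sample_hull x N) K \<le> (1 + \<eta> / r) / (1 - \<eta> / r)"
  unfolding sample_hull_def
proof (rule bm_dist_convex_hull_le[OF K _ R(1) \<eta>])
  fix p assume "p \<in> x ` {..<N}"
  then obtain g where g: "g \<in> G" "dist (a g) p < 1" using stay by fastforce
  from atoms[OF g(1)] show "\<exists>y\<in>K. dist p (R *\<^sub>R (y - z)) \<le> R * \<eta>"
  proof
    assume "\<exists>v\<in>F. a g = R *\<^sub>R v"
    then obtain v where v: "v \<in> F" "a g = R *\<^sub>R v" by blast
    have "dist p (R *\<^sub>R ((z + v) - z)) \<le> R * \<eta>" using g(2) v(2) R by (simp add: dist_commute)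
    then show ?thesis using F(1) v(1) by blast
  next
    assume "norm (a g) + 1 \<le> R * \<eta>"
    then have "norm p \<le> R * \<eta>"
      using g(2) norm_triangle_ineq2[of p "a g"] by (simp add: dist_norm norm_minus_commute)
    moreover have "z \<in> K" using K(3) \<eta> by auto
    ultimately show ?thesis by (intro bexI[of _ z]) auto
  qed
next
  fix y assume "y \<in> K"
  then obtain v where v: "v \<in> F" "dist v (y - z) < \<eta> / 2" using F(2) by blast
  obtain n where n: "n < N" "dist (R *\<^sub>R v) (x n) < 1" using hit[OF v(1)] by auto
  have "dist (R *\<^sub>R v) (R *\<^sub>R (y - z)) = R * dist v (y - z)"
    using R(1) by (simp add: dist_norm flip: scaleR_diff_right)
  also have "\<dots> \<le> R * (\<eta> / 2)" using v(2) R(1) by (intro mult_left_mono) auto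
  finally have "dist (x n) (R *\<^sub>R (y - z)) \<le> 1 + R * (\<eta> / 2)"
    using n(2) dist_triangle[of "x n" "R *\<^sub>R (y - z)" "R *\<^sub>R v"] by (simp add: dist_commute)
  also have "\<dots> \<le> R * \<eta>" using R(2) by simp
  finally show "\<exists>p\<in>x ` {..<N}. dist p (R *\<^sub>R (y - z)) \<le> R * \<eta>" using n(1) by blast
qed simp

theorem exists_measure_dense_sample_hulls:
  "\<exists>\<mu> :: 'a::euclidean_space measure. prob_space \<mu> \<and> sets \<mu> = sets borel \<and>
     (AE x in (\<Pi>\<^sub>M i\<in>(UNIV :: nat set). \<mu>). bm_dense (sample_hull x ` {n. n \<ge> DIM('a) + 1}))"
proof -
  obtain L :: "nat \<Rightarrow> 'a list" where L: "\<And>K \<eta>. K \<in> convex_bodies \<Longrightarrow> 0 < \<eta> \<Longrightarrow>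
    \<exists>F. set F \<subseteq> K \<and> (\<forall>y\<in>K. \<exists>v\<in>set F. dist v y < \<eta>) \<and> infinite {k. L k = F}"
    by (rule exists_vertex_lists) (rule that)
  obtain J N :: "nat \<Rightarrow> nat" and R :: "nat \<Rightarrow> real" and a :: "nat \<Rightarrow> 'a"
  where N: "\<And>k. DIM('a) + 1 \<le> N k"
    and hit_le: "\<And>k. real (length (L k)) * (1 - (1/2) ^ (J k + length (L k))) ^ N k \<le> (1/2) ^ k"
    and stay_le: "\<And>k. real (N k) * (1/2) ^ J (Suc k) \<le> (1/2) ^ k"
    and R: "\<And>k. real (Suc k) \<le> R k"
    and vertex: "\<And>k v. v \<in> set (L k) \<Longrightarrow> \<exists>g<J k + length (L k). a g = R k *\<^sub>R v"
    and atoms: "\<And>k g. g < J (Suc k) \<Longrightarrow> (\<exists>v\<in>set (L k). a g = R k *\<^sub>R v) \<or> norm (a g) + 1 \<le> R k / real (Suc k)"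
    by (rule exists_atoms[of "DIM('a) + 1" L]) (rule that)
  define p where "p = geometric_pmf (1/2)"
  define \<mu> where "\<mu> = jittered p a"
  interpret \<mu>: prob_space \<mu> unfolding \<mu>_def by (rule prob_space_jittered)
  interpret sequence_space \<mu> ..
  have sets_\<mu> [simp, measurable_cong]: "sets \<mu> = sets borel" by (simp add: \<mu>_def)
  define W where "W k = (\<Union>g\<in>{..<J (Suc k)}. ball (a g) 1)" for k
  define Bad where "Bad k = {x \<in> space S.
      (\<exists>n<N k. x n \<notin> W k) \<or> (\<exists>v\<in>set (L k). \<forall>n<N k. x n \<notin> ball (R k *\<^sub>R v) 1)}" for k
  have W [measurable]: "W k \<in> sets \<mu>" for k by (auto simp: W_def)
  \<comment> \<open>The trivial lower bound 0 for the hitting probabilities: only measurability is extracted here.\<close>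
  have Bad: "Bad k \<in> P.events" for k 
    unfolding Bad_def by (rule prob_miss_or_escape_le(1)[where q = 0, OF W]) auto
  have prob_Bad: "P.prob (Bad k) \<le> 2 * (1/2) ^ k" for k
  proof -
    let ?m = "length (L k)"
    have "measure \<mu> (ball (R k *\<^sub>R v) 1) \<ge> (1/2) ^ (J k + ?m)" if v: "v \<in> set (L k)" for v
    proof -
      obtain g where g: "g < J k + ?m" "a g = R k *\<^sub>R v" using vertex[OF v] by blast
      have "(1/2) ^ (J k + ?m) \<le> (1/2::real) ^ Suc g" using g(1) by (intro power_decreasing) auto
      also have "\<dots> = measure_pmf.prob p {g}" by (simp add: p_def measure_pmf_single)
      also have "\<dots> \<le> measure \<mu> (ball (R k *\<^sub>R v) 1)"
        using measure_jittered_balls_ge[of p "{g}" a] g(2) by (simp add: \<mu>_def)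
      finally show ?thesis .
    qed
    then have "P.prob (Bad k) \<le> real (N k) * (1 - measure \<mu> (W k))
        + real (card (set (L k))) * (1 - (1/2) ^ (J k + ?m)) ^ N k"
      unfolding Bad_def by (intro prob_miss_or_escape_le(2) W) auto
    also have "\<dots> \<le> real (N k) * (1/2) ^ J (Suc k) + real ?m * (1 - (1/2) ^ (J k + ?m)) ^ N k"
    proof (intro add_mono mult_left_mono mult_right_mono)
      show "1 - measure \<mu> (W k) \<le> (1/2) ^ J (Suc k)"
        using measure_jittered_balls_ge[of p "{..<J (Suc k)}" a]
        by (simp add: W_def \<mu>_def p_def prob_geometric_half_lessThan)
    qed (auto simp: card_length power_le_one)
    also have "\<dots> \<le> 2 * (1/2) ^ k" using stay_le[of k] hit_le[of k] by simp
    finally show ?thesis .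
  qed
  have "summable (\<lambda>k. P.prob (Bad k))"
  proof (rule summable_comparison_test')
    show "summable (\<lambda>k. 2 * (1/2) ^ k :: real)" by (intro summable_mult summable_geometric) simp
    show "norm (P.prob (Bad k)) \<le> 2 * (1/2) ^ k" for k using prob_Bad[of k] by simp
  qed
  then have "AE x in S. \<forall>\<^sub>F k in sequentially. x \<in> space S - Bad k"
    using Bad by (intro borel_cantelli_AE1) (auto simp: P.emeasure_eq_measure)
  moreover have "AE x in S. \<forall>i. i \<le> DIM('a) \<longrightarrow> x i \<notin> affine hull (x ` {..<i})"
    unfolding AE_all_countable
  proof
    fix i
    show "AE x in S. i \<le> DIM('a) \<longrightarrow> x i \<notin> affine hull (x ` {..<i})"
      using AE_not_in_affine_hull_of_earlier[of \<mu> i] \<mu>.prob_space_axioms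
      by (cases "i \<le> DIM('a)") (auto simp: \<mu>_def absolutely_continuous_jittered)
  qed
  ultimately have "AE x in S. bm_dense (sample_hull x ` {n. n \<ge> DIM('a) + 1})"
  proof eventually_elim
    fix x :: "nat \<Rightarrow> 'a"
    assume ev: "\<forall>\<^sub>F k in sequentially. x \<in> space S - Bad k"
      and gen: "\<forall>i. i \<le> DIM('a) \<longrightarrow> x i \<notin> affine hull (x ` {..<i})"
    show "bm_dense (sample_hull x ` {n. n \<ge> DIM('a) + 1})"
      unfolding bm_dense_def
    proof (intro conjI ballI allI impI)
      show "sample_hull x ` {n. n \<ge> DIM('a) + 1} \<subseteq> convex_bodies"
        using sample_hull_convex_body[of x] gen by blast
      fix K :: "'a set" and \<epsilon> :: real
      assume K: "K \<in> convex_bodies" and \<epsilon>: "0 < \<epsilon>"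
      then obtain z r where z: "0 < r" "cball z r \<subseteq> K"
        by (auto simp: convex_bodies_def mem_interior_cball)
      \<comment> \<open>With this \<open>t\<close>, the quotient \<open>(1 + t) / (1 - t)\<close> is \<open>1 + 2 * \<epsilon> / 3\<close>.\<close>
      define t where "t = \<epsilon> / (3 + \<epsilon>)"
      have t: "0 < t" "t < 1" "(1 + t) / (1 - t) < 1 + \<epsilon>" using \<epsilon> by (auto simp: t_def field_simps intro!: add_pos_pos)
      define \<eta> where "\<eta> = r * t"
      have \<eta>: "0 < \<eta>" "\<eta> < r" "\<eta> / r = t" using t z by (auto simp: \<eta>_def)
      have "(\<lambda>y. - z + y) ` K \<in> convex_bodies"
        using K by (simp add: convex_bodies_def compact_translation convex_translation
            interior_translation del: uminus_add_conv_diff)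
      then obtain F where F: "set F \<subseteq> (\<lambda>y. - z + y) ` K"
          "\<And>y. y \<in> K \<Longrightarrow> \<exists>v\<in>set F. dist v (y - z) < \<eta> / 2" "infinite {k. L k = F}"
        using L[of "(\<lambda>y. - z + y) ` K" "\<eta> / 2"] \<eta>(1) by auto
      obtain k0 where k0: "\<And>k. k0 \<le> k \<Longrightarrow> x \<in> space S - Bad k"
        using ev by (auto simp: eventually_sequentially)
      \<comment> \<open>From \<open>k1\<close> on, \<open>R k \<ge> Suc k\<close> makes the unit displacement at most half of \<open>R k * \<eta>\<close>.\<close>
      obtain k1 :: nat where k1: "2 / \<eta> < real k1" using reals_Archimedean2 by blast
      obtain k where k: "max k0 k1 \<le> k" "L k = F"
        using F(3) unfolding infinite_nat_iff_unbounded_le by blast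
      have Rk: "0 < R k" using R[of k] by simp
      have "2 / \<eta> \<le> real (Suc k)" using k1 k(1) by simp
      then have k\<eta>: "2 \<le> real (Suc k) * \<eta>" using \<eta>(1) by (simp add: field_simps)
      have good: "\<And>n. n < N k \<Longrightarrow> x n \<in> W k" "\<And>v. v \<in> set F \<Longrightarrow> \<exists>n<N k. x n \<in> ball (R k *\<^sub>R v) 1"
        using k0[of k] k unfolding Bad_def by auto
      have "bm_dist (sample_hull x (N k)) K \<le> (1 + \<eta> / r) / (1 - \<eta> / r)"
      proof (rule bm_dist_sample_hull_le[where R = "R k" and F = "set F" and a = a and G = "{..<J (Suc k)}"])
        show "compact K" "convex K" using K by (auto simp: convex_bodies_def)
        show "2 \<le> R k * \<eta>"
          using k\<eta> mult_right_mono[OF R[of k], of \<eta>] \<eta>(1) by linarith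
        have "1 / real (Suc k) \<le> \<eta>" using k\<eta> by (simp add: field_simps)
        then have le: "R k / real (Suc k) \<le> R k * \<eta>"
          using mult_left_mono[of "1 / real (Suc k)" \<eta> "R k"] Rk by simp
        show "(\<exists>v\<in>set F. a g = R k *\<^sub>R v) \<or> norm (a g) + 1 \<le> R k * \<eta>" if "g \<in> {..<J (Suc k)}" for g
          using atoms[of g k] le that k(2) by auto
      qed (use z \<eta> Rk F good in \<open>auto simp: W_def\<close>)
      then have "bm_dist (sample_hull x (N k)) K < 1 + \<epsilon>" using t(3) unfolding \<eta>(3) by linarith
      then show "\<exists>P\<in>sample_hull x ` {n. n \<ge> DIM('a) + 1}. bm_dist P K < 1 + \<epsilon>" using N by blast
    qed
  qed
  then show ?thesis using \<mu>.prob_space_axioms sets_\<mu> by blast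
qed

theorem theorem4:
  "\<exists>\<mu> :: (real ^ 'd) measure. prob_space \<mu> \<and> sets \<mu> = sets borel \<and>
     (AE x in (\<Pi>\<^sub>M i\<in>(UNIV :: nat set). \<mu>).
        bm_dense (sample_hull x ` {n. n \<ge> CARD('d) + 1}))"
  using exists_measure_dense_sample_hulls[where 'a = "real ^ 'd"] by simp

end
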